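(* Let $(X,\tau)$ be a topological space. Then the diagonal $\Delta=\{(x,x):x\in X\}$ is a $G_\delta$ subset of $X\times X$ if and only if $S_1(\mathcal{O},\mathcal{H})$ does not hold for $X$. Moreover, if $S_1(\mathcal{O},\mathcal{H})$ does not hold for $X$, then Player I has a winning strategy in the game $G_1(\mathcal{O},\mathcal{H})$ played on $X$.
   Context: $\mathcal{O}$ denotes the set of all open covers of the space $X$, and $\mathcal{H}=\{R\in(\tau\setminus\{\emptyset\})^{\omega}:|\bigcap R|\geq 2\}$. The selection principle $S_1(\mathcal{O},\mathcal{H})$ is the statement: given any sequence $(\mathcal{C}_n)_{n\in\omega}$ of elements of $\mathcal{O}$, for each $n\in\omega$ there is a $C_n\in\mathcal{C}_n$ such that $|\bigcap_{n\in\omega}C_n|\geq 2$. The game $G_1(\mathcal{O},\mathcal{H})$ on $X$: in the $n$-th inning ($n\in\omega$) Player I plays some $\mathcal{C}_n\in\mathcal{O}$ and then Player II chooses some $C_n\in\mathcal{C}_n$. At the end, Player II wins if $|\bigcap_{n\in\omega}C_n|\geq 2$; otherwise Player I wins. *)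

theory Defs
  imports "HOL-Analysis.Analysis"
begin

definition open_covers :: "'a topology \<Rightarrow> 'a set set set" where
  "open_covers X = {\<C>. (\<forall>U\<in>\<C>. openin X U) \<and> \<Union>\<C> = topspace X}"

text \<open>
  The bound on the size of the intersection is a comparison of cardinals: \<open>card\<close> is
  \<open>0\<close> on infinite sets.
\<close>

definition thick_sequences :: "'a topology \<Rightarrow> (nat \<Rightarrow> 'a set) set" where
  "thick_sequences X =
     {R. (\<forall>n. openin X (R n) \<and> R n \<noteq> {}) \<and> {..<2::nat} \<lesssim> (\<Inter>n. R n)}"

definition S1 :: "'b set set \<Rightarrow> (nat \<Rightarrow> 'b) set \<Rightarrow> bool" where
  "S1 \<A> \<B> \<longleftrightarrow>
     (\<forall>A. (\<forall>n. A n \<in> \<A>) \<longrightarrow> (\<exists>b. (\<forall>n. b n \<in> A n) \<and> b \<in> \<B>))"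

text \<open>
  In the game \<open>G\<^sub>1(\<A>, \<B>)\<close>, a strategy for Player I maps the finite list of Player II's
  previous moves (oldest first) to Player I's next move.  Player I's own earlier moves are
  determined by the strategy and so are not part of its argument.  It is winning if every
  infinite play against it in which Player II always moves legally is won by Player I.
\<close>

definition G1_strategy_I :: "'b set set \<Rightarrow> ('b list \<Rightarrow> 'b set) \<Rightarrow> bool" where
  "G1_strategy_I \<A> \<sigma> \<longleftrightarrow> (\<forall>s \<in> lists (\<Union>\<A>). \<sigma> s \<in> \<A>)"

definition G1_winning_strategy_I ::
    "'b set set \<Rightarrow> (nat \<Rightarrow> 'b) set \<Rightarrow> ('b list \<Rightarrow> 'b set) \<Rightarrow> bool" where
  "G1_winning_strategy_I \<A> \<B> \<sigma> \<longleftrightarrow>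
     G1_strategy_I \<A> \<sigma> \<and>
     (\<forall>b. (\<forall>n. b n \<in> \<sigma> (map b [0..<n])) \<longrightarrow> b \<notin> \<B>)"

end

theory Submission
  imports Defs
begin

text \<open>
  An open cover \<open>\<C>\<close> gives the open neighbourhood \<open>\<Union>{U \<times> U | U \<in> \<C>}\<close> of the diagonal.  A pair
  \<open>(x, y)\<close> lies in all the neighbourhoods obtained from a sequence of covers precisely when one
  can select from each cover a member containing both \<open>x\<close> and \<open>y\<close>.  So these neighbourhoods meet
  in the diagonal alone iff no selection from the covers has two points in its intersection,
  that is, iff the sequence of covers witnesses the failure of \<open>S\<^sub>1(\<O>, \<H>)\<close>.

  Conversely, an open neighbourhood \<open>G\<close> of the diagonal gives the open cover by those \<open>U\<close> with
  \<open>U \<times> U \<subseteq> G\<close>.  The neighbourhood of the diagonal obtained from this cover is contained in \<open>G\<close>,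
  so any \<open>G\<^sub>\<delta>\<close> representation of the diagonal can be refined to one that comes from covers.

  Such a witnessing sequence is itself a winning strategy for Player I, who plays its terms
  in order regardless of Player II's answers.
\<close>

lemma two_lepoll_iff: "{..<2::nat} \<lesssim> S \<longleftrightarrow> (\<exists>x\<in>S. \<exists>y\<in>S. x \<noteq> y)"
proof
  assume "{..<2::nat} \<lesssim> S"
  then obtain f where "inj_on f {..<2::nat}" "f ` {..<2} \<subseteq> S"
    unfolding lepoll_def by blast
  then have "f 0 \<in> S" "f 1 \<in> S" "f 0 \<noteq> f 1"
    by (auto simp: inj_on_eq_iff)
  then show "\<exists>x\<in>S. \<exists>y\<in>S. x \<noteq> y" by blast
next
  assume "\<exists>x\<in>S. \<exists>y\<in>S. x \<noteq> y"
  then obtain x y where "x \<in> S" "y \<in> S" "x \<noteq> y" by blast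
  then have "inj_on (\<lambda>n. if n = 0 then x else y) {..<2::nat}"
    "(\<lambda>n. if n = 0 then x else y) ` {..<2::nat} \<subseteq> S"
    by (auto simp: inj_on_def less_2_cases_iff)
  then show "{..<2::nat} \<lesssim> S" unfolding lepoll_def by blast
qed

lemma thick_sequences_iff:
  "R \<in> thick_sequences X \<longleftrightarrow>
     (\<forall>n. openin X (R n)) \<and> (\<exists>x y. x \<noteq> y \<and> (\<forall>n. x \<in> R n \<and> y \<in> R n))"
proof -
  have "(\<exists>x\<in>\<Inter>n. R n. \<exists>y\<in>\<Inter>n. R n. x \<noteq> y) \<longleftrightarrow>
      (\<exists>x y. x \<noteq> y \<and> (\<forall>n. x \<in> R n \<and> y \<in> R n))"
    by (simp add: Bex_def) metis
  then show ?thesis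
    unfolding thick_sequences_def two_lepoll_iff mem_Collect_eq by fastforce
qed

lemma not_S1_if_gdelta_diagonal:
  fixes X :: "'a topology"
  assumes "gdelta_in (prod_topology X X) {(x, x) |x. x \<in> topspace X}"
  shows "\<not> S1 (open_covers X) (thick_sequences X)"
proof -
  obtain G where "(\<forall>n. openin (prod_topology X X) (G n)) \<and> (\<forall>n. G (Suc n) \<subseteq> G n) \<and>
      (\<Inter>n. G n) = {(x, x) |x. x \<in> topspace X}"
    using assms[unfolded gdelta_in_descending] by (rule exE)
  then have G: "\<And>n. openin (prod_topology X X) (G n)"
    and diag: "(\<Inter>n. G n) = {(x, x) |x. x \<in> topspace X}"
    by simp_all
  define A where "A n = {U. openin X U \<and> U \<times> U \<subseteq> G n}" for n
  have "A n \<in> open_covers X" for n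
  proof -
    have "\<exists>U\<in>A n. x \<in> U" if "x \<in> topspace X" for x
    proof -
      have "(x, x) \<in> G n" using diag that by blast
      then obtain U V where "openin X U" "openin X V" "x \<in> U" "x \<in> V" "U \<times> V \<subseteq> G n"
        using G[of n] unfolding openin_prod_topology_alt by metis
      \<comment> \<open>a basic box around a diagonal point contains a square around it\<close>
      then show ?thesis
        by (intro bexI[of _ "U \<inter> V"]) (auto simp: A_def)
    qed
    then show ?thesis
      by (auto simp: open_covers_def A_def dest: openin_subset)
  qed
  moreover have "b \<notin> thick_sequences X" if b: "\<forall>n. b n \<in> A n" for b
  proof
    assume "b \<in> thick_sequences X"
    then obtain x y where "x \<noteq> y" "\<forall>n. x \<in> b n \<and> y \<in> b n"
      unfolding thick_sequences_iff by blast
    then have "(x, y) \<in> (\<Inter>n. G n)" using b by (fastforce simp: A_def)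
    then show False using \<open>x \<noteq> y\<close> diag by auto
  qed
  ultimately show ?thesis unfolding S1_def by blast
qed

lemma gdelta_diagonal_if_not_S1:
  assumes "\<not> S1 (open_covers X) (thick_sequences X)"
  shows "gdelta_in (prod_topology X X) {(x, x) |x. x \<in> topspace X}"
proof -
  obtain A where A: "\<And>n. A n \<in> open_covers X"
    and not_thick: "\<And>b. (\<And>n. b n \<in> A n) \<Longrightarrow> b \<notin> thick_sequences X"
    using assms unfolding S1_def by blast
  define G where "G n = (\<Union>U\<in>A n. U \<times> U)" for n
  have G: "openin (prod_topology X X) (G n)" for n
    using A[of n] unfolding G_def open_covers_def
    by (auto intro!: openin_Union simp: openin_prod_Times_iff)
  have "(\<Inter>n. G n) = {(x, x) |x. x \<in> topspace X}"
  proof (intro equalityI subsetI)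
    fix p assume "p \<in> (\<Inter>n. G n)"
    then obtain x y where p: "p = (x, y)" and "\<And>n. \<exists>U\<in>A n. x \<in> U \<and> y \<in> U"
      unfolding G_def by (cases p) auto
    then obtain b where b: "\<And>n. b n \<in> A n" and xy: "\<And>n. x \<in> b n" "\<And>n. y \<in> b n"
      by metis
    have op: "openin X (b n)" for n using A b unfolding open_covers_def by blast
    then have "x = y" using not_thick[OF b] xy unfolding thick_sequences_iff by blast
    moreover have "x \<in> topspace X" using op xy openin_subset by blast
    ultimately show "p \<in> {(x, x) |x. x \<in> topspace X}" using p by blast
  next
    fix p assume "p \<in> {(x, x) |x. x \<in> topspace X}"
    then show "p \<in> (\<Inter>n. G n)" using A unfolding G_def open_covers_def by blast
  qed
  moreover have "gdelta_in (prod_topology X X) (\<Inter>n. G n)"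
    by (rule gdelta_in_Inter) (auto intro: open_imp_gdelta_in G)
  ultimately show ?thesis by simp
qed

text \<open>
  Player I can ignore the content of Player II's moves: the length of the history tells
  which cover of a fixed witnessing sequence is due.
\<close>

lemma winning_strategy_I_if_not_S1:
  assumes "\<not> S1 \<A> \<B>"
  shows "\<exists>\<sigma>. G1_winning_strategy_I \<A> \<B> \<sigma>"
proof -
  obtain A where "\<And>n. A n \<in> \<A>" "\<And>b. (\<forall>n. b n \<in> A n) \<Longrightarrow> b \<notin> \<B>"
    using assms unfolding S1_def by blast
  then have "G1_winning_strategy_I \<A> \<B> (\<lambda>s. A (length s))"
    unfolding G1_winning_strategy_I_def G1_strategy_I_def by simp
  then show ?thesis by blast
qed

theorem mainTheorem1:
  fixes X :: "'a topology"
  shows "(gdelta_in (prod_topology X X) {(x, x) |x. x \<in> topspace X} \<longleftrightarrow>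
            \<not> S1 (open_covers X) (thick_sequences X)) \<and>
         (\<not> S1 (open_covers X) (thick_sequences X) \<longrightarrow>
            (\<exists>\<sigma>. G1_winning_strategy_I (open_covers X) (thick_sequences X) \<sigma>))"
  using not_S1_if_gdelta_diagonal gdelta_diagonal_if_not_S1 winning_strategy_I_if_not_S1
  by blast

end
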